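(* Let the layers of the Pearl Causal Hierarchy be indexed by $\{1,2,2.25,2.5,3\}$, as defined in the context. For every layer index $i$: (1) For every causal diagram $\mathcal G$ and query $Q=P(\mathbf Y_\star)$ belonging to $\mathcal L_i$ relative to $\mathcal G$: if $Q$ is identifiable from $\mathcal G$ and $\mathcal L_j$ data for some $j<i$, then $Q$ belongs to $\mathcal L_{2.5}$ relative to $\mathcal G$. (2) (for $i>1$) It is not true in general that a query $Q\in\mathcal L_i$ identifiable from $\mathcal L_j$ data, $j<i$, belongs to $\mathcal L_j$: there exist $j<i$, a causal diagram $\mathcal G$ and a query $Q$ in $\mathcal L_i$ that is identifiable from $\mathcal G$ and $\mathcal L_j$ data but does not belong to $\mathcal L_j$. (3) For every causal diagram $\mathcal G$ and query $Q$ in $\mathcal L_i$: if $Q$ is realizable (given the permitted actions), then $Q$ is identifiable from $\mathcal G$ and the available data. (4) (for $i>1$) It is not true in general that a realizable query in $\mathcal L_i$ is identifiable from $\mathcal L_j$ data with $j<i$: there exist $j<i$, a causal diagram $\mathcal G$, permitted actions and a realizable query $Q$ in $\mathcal L_i$ that is not identifiable from $\mathcal G$ and $\mathcal L_j$ data.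
   Context: **SCMs and diagrams.** A (recursive) SCM $\mathcal M=\langle\mathbf V,\mathbf U,\mathcal F,P(\mathbf u)\rangle$ has finitely many observable finite-domain variables $\mathbf V$, exogenous $\mathbf U\sim P(\mathbf u)$, and functions $V_i\leftarrow f_i(\mathbf{Pa}_i,\mathbf U_i)$, acyclic. A causal diagram $\mathcal G$ has vertices $\mathbf V$, directed and bidirected edges; $\mathcal M$ is compatible with $\mathcal G$ if $\mathbf{Pa}_i$ are the parents of $V_i$ in $\mathcal G$ and $\mathbf U_i,\mathbf U_j$ may be dependent only if $V_i\leftrightarrow V_j$ is in $\mathcal G$ (functions may ignore arguments). $\mathcal G_{\overline{\mathbf X}}$ (resp. $\mathcal G_{\underline{\mathbf X}}$) removes edges into (resp. out of) $\mathbf X$; $An(\cdot)$ denotes ancestors, including the vertex itself. $Y_{\mathbf x}(\mathbf u)$, $Y\notin\mathbf X$, is the value of $Y$ when the functions of $\mathbf X$ are replaced by constants $\mathbf x$. For a set $\mathbf Y_\star$ of potential responses, $P(\mathbf Y_\star=\mathbf y)=\sum_{\mathbf u}\prod_{Y_{\mathbf x}\in\mathbf Y_\star}\mathbb 1[Y_{\mathbf x}(\mathbf u)=y]P(\mathbf u)$. All distributions used as data are assumed positive. A query $Q$ is a distribution $P(\mathbf Y_\star)$ (values $\mathbf y$ are free indices). **Layers**, relative to $\mathcal G$ (a containment hierarchy: higher layers contain lower ones): - $\mathcal L_1$: all subscripts in $\mathbf Y_\star$ are empty. $\mathcal L_2$: all subscripts are the same $\mathbf x$. $\mathcal L_3$: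 all $P(\mathbf Y_\star)$. - $\mathcal L_{2.25}$: there are $\mathbf X\subseteq\mathbf V$ and a single value vector $\mathbf x$ such that $\mathbf Y_\star$ contains at most one potential response $V_{j[\mathbf x_j]}$ of each variable, each $\mathbf x_j$ is a sub-vector of $\mathbf x$ not involving $V_j$, and whenever $X\in\mathbf X\setminus\{V_j\}$ is an ancestor of $V_j$ in $\mathcal G_{\overline{\mathbf X\setminus\{V_j\}}}$, the value of $X$ in $\mathbf x$ is included in $\mathbf x_j$. - $\mathcal L_{2.5}$: distributions physically realizable, in principle, if counterfactual randomization were available for every edge of $\mathcal G$. Equivalently: $An(\mathbf Y_\star)=\bigcup_{Y_{\mathbf x}\in\mathbf Y_\star}\{W_{\mathbf z}:W\in An(Y)_{\mathcal G_{\underline{\mathbf X}}},\ \mathbf z=\mathbf x\cap An(W)_{\mathcal G_{\overline{\mathbf X}}}\}$ contains no pair $W_{\mathbf t},W_{\mathbf s}$ of the same variable with $\mathbf t\ne\mathbf s$. **Realizability.** Actions are $rand(X)$ (the natural value of $X$ is erased and replaced by an assigned value) and $ctf\text{-}rand(X\to\mathbf C)$, $\mathbf C\subseteq Ch(X)$ (only the value of $X$ perceived by children in $\mathbf C$ is replaced by an assigned value; natural $X$ is still measured). A regime is a set of permitted actions (possibly empty: passive observation); under it each variable is generated by its own function from the perceived parent values, and the joint distribution of all variables not subject to $rand$ is sampled, for all assigned values. $Q$ is realizable if it is (a marginal of) a distribution sampled in some regime of permitted actions; the available data is the collection of all distributions sampled in regimes of permitted actions. **Identifiability.** $Q$ is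 identifiable from $\mathcal G$ and a collection of distributions (e.g. all distributions in $\mathcal L_j$ relative to $\mathcal G$) if any two SCMs compatible with $\mathcal G$ (with the same finite domains) agreeing on that collection agree on $P(\mathbf Y_\star=\mathbf y)$ for every $\mathbf y$. *)

theory Defs
  imports "HOL-Probability.Probability"
begin

text \<open>
  Variables and their values are named by natural numbers. Diagrams and domains are finite, so this
  loses no generality, and it allows quantification over all diagrams, domains and models inside a
  formula.
\<close>

type_synonym var = nat
type_synonym val = nat


section \<open>Causal diagrams\<close>

record diagram =
  verts :: "var set"
  dir :: "(var \<times> var) set"
  bidir :: "(var \<times> var) set"

definition causal_diagram :: "diagram \<Rightarrow> bool" where
  "causal_diagram G \<longleftrightarrow>
     finite (verts G) \<and> dir G \<subseteq> verts G \<times> verts G \<and> acyclic (dir G) \<and>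
     bidir G \<subseteq> verts G \<times> verts G \<and> sym (bidir G) \<and> irrefl (bidir G)"

definition parents :: "diagram \<Rightarrow> var \<Rightarrow> var set" where
  "parents G v = {w. (w, v) \<in> dir G}"

definition children :: "diagram \<Rightarrow> var \<Rightarrow> var set" where
  "children G v = {w. (v, w) \<in> dir G}"

definition An :: "diagram \<Rightarrow> var \<Rightarrow> var set" where
  "An G v = {w. (w, v) \<in> (dir G)\<^sup>*}"

text \<open>
  The mutilated graphs with an overlined, respectively underlined, vertex set. A bidirected edge
  has an arrowhead at both ends, so it counts as an edge into each of its endpoints.
\<close>

definition cut_in :: "diagram \<Rightarrow> var set \<Rightarrow> diagram" where
  "cut_in G X = G\<lparr>dir := {(a, b) \<in> dir G. b \<notin> X},
                  bidir := {(a, b) \<in> bidir G. a \<notin> X \<and> b \<notin> X}\<rparr>"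

definition cut_out :: "diagram \<Rightarrow> var set \<Rightarrow> diagram" where
  "cut_out G X = G\<lparr>dir := {(a, b) \<in> dir G. a \<notin> X}\<rparr>"


section \<open>Structural causal models\<close>

text \<open>
  \<open>mech M v p e\<close> is the value of \<open>v\<close> when its parents have the values \<open>p\<close> and its
  exogenous variable has the value \<open>e\<close>; \<open>exo M\<close> is the joint law of the family of all
  exogenous variables, indexed by the observable variable they feed. Exogenous values are natural
  numbers: under a discrete joint law each exogenous variable takes countably many values.
\<close>

record scm =
  vals :: "var \<Rightarrow> val set"
  mech :: "var \<Rightarrow> (var \<Rightarrow> val) \<Rightarrow> nat \<Rightarrow> val"
  exo :: "(var \<Rightarrow> nat) pmf"

text \<open>
  Dependence only along bidirected edges is required between groups of exogenous variables, as is
  usual for semi-Markovian models; for singletons it is the pairwise condition.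
\<close>

definition compatible :: "scm \<Rightarrow> diagram \<Rightarrow> bool" where
  "compatible M G \<longleftrightarrow>
     (\<forall>v\<in>verts G. finite (vals M v) \<and> vals M v \<noteq> {}) \<and>
     (\<forall>v\<in>verts G. \<forall>p q e. (\<forall>w\<in>parents G v. p w = q w) \<longrightarrow> mech M v p e = mech M v q e) \<and>
     (\<forall>v\<in>verts G. \<forall>p e. (\<forall>w\<in>parents G v. p w \<in> vals M w) \<longrightarrow> mech M v p e \<in> vals M v) \<and>
     (\<forall>A B. A \<subseteq> verts G \<longrightarrow> B \<subseteq> verts G \<longrightarrow> A \<inter> B = {} \<longrightarrow> bidir G \<inter> A \<times> B = {} \<longrightarrow>
        prob_space.indep_var (measure_pmf (exo M))
          (count_space UNIV) (\<lambda>u. restrict u A) (count_space UNIV) (\<lambda>u. restrict u B))"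

text \<open>
  The solution of a system of structural equations \<open>s v = F v s\<close>; it is unique when each
  \<open>F v\<close> reads only the parents of \<open>v\<close> in a finite acyclic graph on \<open>S\<close>.
\<close>

definition solution :: "var set \<Rightarrow> (var \<Rightarrow> (var \<Rightarrow> val) \<Rightarrow> val) \<Rightarrow> var \<Rightarrow> val" where
  "solution S F = (THE s. s \<in> extensional S \<and> (\<forall>v\<in>S. s v = F v s))"


section \<open>Potential responses and queries\<close>

text \<open>
  The pair \<open>(Y, x)\<close> stands for the potential response of \<open>Y\<close> under the partial
  assignment \<open>x\<close>; a query is given by its set of potential responses.
\<close>

type_synonym response = "var \<times> (var \<rightharpoonup> val)"
type_synonym query = "response set"

definition potential_value :: "scm \<Rightarrow> diagram \<Rightarrow> response \<Rightarrow> (var \<Rightarrow> nat) \<Rightarrow> val" where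
  "potential_value M G r u =
     solution (verts G)
       (\<lambda>v s. case snd r v of Some a \<Rightarrow> a | None \<Rightarrow> mech M v s (u v)) (fst r)"

definition ctf_dist :: "scm \<Rightarrow> diagram \<Rightarrow> query \<Rightarrow> (response \<Rightarrow> val) pmf" where
  "ctf_dist M G Q = map_pmf (\<lambda>u. \<lambda>r\<in>Q. potential_value M G r u) (exo M)"

lemma pmf_ctf_dist:
  assumes "y \<in> extensional Q"
  shows "pmf (ctf_dist M G Q) y =
         measure_pmf.prob (exo M) {u. \<forall>r\<in>Q. potential_value M G r u = y r}"
proof -
  have "(\<lambda>u. \<lambda>r\<in>Q. potential_value M G r u) -` {y} =
        {u. \<forall>r\<in>Q. potential_value M G r u = y r}"
    using assms by (auto simp: extensional_def restrict_def fun_eq_iff)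
  then show ?thesis
    by (simp add: ctf_dist_def pmf_map)
qed

definition wf_query :: "diagram \<Rightarrow> query \<Rightarrow> bool" where
  "wf_query G Q \<longleftrightarrow>
     finite Q \<and> (\<forall>(Y, x)\<in>Q. Y \<in> verts G \<and> dom x \<subseteq> verts G \<and> Y \<notin> dom x)"

definition query_over :: "(var \<Rightarrow> val set) \<Rightarrow> query \<Rightarrow> bool" where
  "query_over D Q \<longleftrightarrow> (\<forall>(Y, x)\<in>Q. \<forall>v\<in>dom x. the (x v) \<in> D v)"


section \<open>The layers of the hierarchy\<close>

datatype layer = L1 | L2 | L2_25 | L2_5 | L3

primrec layer_index :: "layer \<Rightarrow> rat" where
  "layer_index L1 = 1"
| "layer_index L2 = 2"
| "layer_index L2_25 = 2.25"
| "layer_index L2_5 = 2.5"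
| "layer_index L3 = 3"

definition ctf_An :: "diagram \<Rightarrow> query \<Rightarrow> response set" where
  "ctf_An G Q =
     (\<Union>(Y, x)\<in>Q. (\<lambda>W. (W, x |` An (cut_in G (dom x)) W)) ` An (cut_out G (dom x)) Y)"

primrec in_layer_shape :: "layer \<Rightarrow> diagram \<Rightarrow> query \<Rightarrow> bool" where
  "in_layer_shape L1 G Q \<longleftrightarrow> (\<forall>(Y, x)\<in>Q. x = Map.empty)"
| "in_layer_shape L2 G Q \<longleftrightarrow> (\<exists>x. \<forall>(Y, x')\<in>Q. x' = x)"
| "in_layer_shape L2_25 G Q \<longleftrightarrow>
     (\<exists>x. dom x \<subseteq> verts G \<and> inj_on fst Q \<and>
        (\<forall>(V, xV)\<in>Q. xV \<subseteq>\<^sub>m x \<and> V \<notin> dom xV \<and>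
           (\<forall>X\<in>dom x - {V}. X \<in> An (cut_in G (dom x - {V})) V \<longrightarrow> xV X = x X)))"
| "in_layer_shape L2_5 G Q \<longleftrightarrow>
     (\<forall>W t s. (W, t) \<in> ctf_An G Q \<longrightarrow> (W, s) \<in> ctf_An G Q \<longrightarrow> t = s)"
| "in_layer_shape L3 G Q \<longleftrightarrow> True"

definition in_layer :: "layer \<Rightarrow> diagram \<Rightarrow> query \<Rightarrow> bool" where
  "in_layer i G Q \<longleftrightarrow> wf_query G Q \<and> in_layer_shape i G Q"


section \<open>Actions, regimes and realizability\<close>

datatype action = Rand (target: var) | CtfRand (target: var) "var set"

definition actions :: "diagram \<Rightarrow> action set" where
  "actions G = {Rand X | X. X \<in> verts G} \<union> {CtfRand X C | X C. X \<in> verts G \<and> C \<subseteq> children G X}"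

text \<open>
  Assigned values for the actions of a regime. If two actions replace the value of the same variable
  perceived by a common child, they must assign the same value, so that every child perceives
  exactly one value.
\<close>

definition assignment :: "(var \<Rightarrow> val set) \<Rightarrow> action set \<Rightarrow> (action \<Rightarrow> val) \<Rightarrow> bool" where
  "assignment D R a \<longleftrightarrow>
     (\<forall>act\<in>R. a act \<in> D (target act)) \<and>
     (\<forall>X C C'. CtfRand X C \<in> R \<longrightarrow> CtfRand X C' \<in> R \<longrightarrow> C \<inter> C' \<noteq> {} \<longrightarrow>
        a (CtfRand X C) = a (CtfRand X C'))"

text \<open>
  The value of \<open>X\<close> perceived by its child \<open>W\<close> when the actual value of \<open>X\<close>
  (the assigned one if \<open>X\<close> is randomized) is \<open>b\<close>. Under \<open>assignment\<close> the choice
  of \<open>C\<close> is immaterial.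
\<close>

definition perceived :: "action set \<Rightarrow> (action \<Rightarrow> val) \<Rightarrow> var \<Rightarrow> var \<Rightarrow> val \<Rightarrow> val" where
  "perceived R a X W b =
     (if \<exists>C. CtfRand X C \<in> R \<and> W \<in> C
      then a (CtfRand X (SOME C. CtfRand X C \<in> R \<and> W \<in> C)) else b)"

definition regime_value ::
  "scm \<Rightarrow> diagram \<Rightarrow> action set \<Rightarrow> (action \<Rightarrow> val) \<Rightarrow> (var \<Rightarrow> nat) \<Rightarrow> var \<Rightarrow> val" where
  "regime_value M G R a u =
     solution (verts G)
       (\<lambda>v s. if Rand v \<in> R then a (Rand v)
              else mech M v (\<lambda>X. perceived R a X v (s X)) (u v))"

definition measured :: "diagram \<Rightarrow> action set \<Rightarrow> var set" where
  "measured G R = {v \<in> verts G. Rand v \<notin> R}"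

definition sampled_dist ::
  "scm \<Rightarrow> diagram \<Rightarrow> action set \<Rightarrow> (action \<Rightarrow> val) \<Rightarrow> (var \<Rightarrow> val) pmf" where
  "sampled_dist M G R a = map_pmf (\<lambda>u. restrict (regime_value M G R a u) (measured G R)) (exo M)"

text \<open>
  The query is a marginal of a sampled distribution if, in every model compatible with the diagram,
  it is the law of the measured variables named by its potential responses. The assigned values may
  depend on the domains, since a regime may act on variables the query does not mention.
\<close>

definition realizable :: "diagram \<Rightarrow> action set \<Rightarrow> query \<Rightarrow> bool" where
  "realizable G A Q \<longleftrightarrow>
     (\<exists>R\<subseteq>A. fst ` Q \<subseteq> measured G R \<and>
        (\<forall>D. (\<forall>v\<in>verts G. finite (D v) \<and> D v \<noteq> {}) \<longrightarrow> query_over D Q \<longrightarrow>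
           (\<exists>a. assignment D R a \<and>
              (\<forall>M. compatible M G \<longrightarrow> (\<forall>v\<in>verts G. vals M v = D v) \<longrightarrow>
                 ctf_dist M G Q = map_pmf (\<lambda>s. \<lambda>r\<in>Q. s (fst r)) (sampled_dist M G R a)))))"


section \<open>Identifiability\<close>

text \<open>
  A collection of distributions enters through two predicates: positivity of the collection in a
  model, and agreement of two models on it. The domains belong to the models and are not fixed in
  advance, except that they contain the values occurring in the query.
\<close>

definition identifiable ::
  "diagram \<Rightarrow> (scm \<Rightarrow> bool) \<Rightarrow> (scm \<Rightarrow> scm \<Rightarrow> bool) \<Rightarrow> query \<Rightarrow> bool" where
  "identifiable G pos agree Q \<longleftrightarrow>
     (\<forall>M N. compatible M G \<longrightarrow> compatible N G \<longrightarrow> (\<forall>v\<in>verts G. vals M v = vals N v) \<longrightarrow>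
        query_over (vals M) Q \<longrightarrow> pos M \<longrightarrow> pos N \<longrightarrow> agree M N \<longrightarrow>
        ctf_dist M G Q = ctf_dist N G Q)"

text \<open>
  Positivity is required of the distributions in which each variable occurs at most once. A set
  such as \<open>{(Y, x), (Y, x')}\<close> with \<open>x\<close> and \<open>x'\<close> acting on non-ancestors
  of \<open>Y\<close> also lies in layer 2.5, but it lists the same random variable twice and has
  probability zero off the diagonal in every model; positivity there would be unsatisfiable.
\<close>

definition layer_positive :: "layer \<Rightarrow> diagram \<Rightarrow> scm \<Rightarrow> bool" where
  "layer_positive j G M \<longleftrightarrow>
     (\<forall>Z. in_layer j G Z \<longrightarrow> query_over (vals M) Z \<longrightarrow> inj_on fst Z \<longrightarrow>
        (\<forall>z \<in> (\<Pi>\<^sub>E r\<in>Z. vals M (fst r)). pmf (ctf_dist M G Z) z > 0))"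

definition layer_agree :: "layer \<Rightarrow> diagram \<Rightarrow> scm \<Rightarrow> scm \<Rightarrow> bool" where
  "layer_agree j G M N \<longleftrightarrow>
     (\<forall>Z. in_layer j G Z \<longrightarrow> query_over (vals M) Z \<longrightarrow> ctf_dist M G Z = ctf_dist N G Z)"

definition identifiable_from_layer :: "diagram \<Rightarrow> layer \<Rightarrow> query \<Rightarrow> bool" where
  "identifiable_from_layer G j Q \<longleftrightarrow> identifiable G (layer_positive j G) (layer_agree j G) Q"

definition available_positive :: "action set \<Rightarrow> diagram \<Rightarrow> scm \<Rightarrow> bool" where
  "available_positive A G M \<longleftrightarrow>
     (\<forall>R\<subseteq>A. \<forall>a. assignment (vals M) R a \<longrightarrow>
        (\<forall>s \<in> (\<Pi>\<^sub>E v\<in>measured G R. vals M v). pmf (sampled_dist M G R a) s > 0))"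

definition available_agree :: "action set \<Rightarrow> diagram \<Rightarrow> scm \<Rightarrow> scm \<Rightarrow> bool" where
  "available_agree A G M N \<longleftrightarrow>
     (\<forall>R\<subseteq>A. \<forall>a. assignment (vals M) R a \<longrightarrow> sampled_dist M G R a = sampled_dist N G R a)"

definition identifiable_from_available :: "diagram \<Rightarrow> action set \<Rightarrow> query \<Rightarrow> bool" where
  "identifiable_from_available G A Q \<longleftrightarrow>
     identifiable G (available_positive A G) (available_agree A G) Q"

end

theory Submission
  imports Defs
begin

text \<open>
  Only the first claim for layer 3 has substance. If \<open>Q\<close> is outside layer 2.5, then a topologically
  first conflict yields an edge from \<open>P\<close> to \<open>W\<close> such that \<open>W\<close> influences two responses of
  \<open>Q\<close>, one of which fixes \<open>P\<close> to \<open>a\<close> while the other does not. Two Markovian models with the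
  same kernels but a different coupling of the responses of \<open>W\<close> to \<open>a\<close> and to the other values of
  \<open>P\<close> then disagree on \<open>Q\<close>. They agree on layer 2.5, whose queries evaluate the mechanism of
  \<open>W\<close> only once for each noise vector.
\<close>

section \<open>Ancestors in mutilated diagrams\<close>

lemma An_refl: "v \<in> An G v"
  by (simp add: An_def)

lemma An_cut_out_edge:
  assumes "b \<in> An (cut_out G X) v" "(a, b) \<in> dir G" "a \<notin> X"
  shows "a \<in> An (cut_out G X) v"
  using assms by (auto simp: An_def cut_out_def intro: converse_rtrancl_into_rtrancl)

lemma An_cut_in_edge:
  assumes "a \<in> An (cut_in G X) b" "(b, v) \<in> dir G" "v \<notin> X"
  shows "a \<in> An (cut_in G X) v"
  using assms by (auto simp: An_def cut_in_def intro: rtrancl_into_rtrancl)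

lemma An_cut_in_antimono: "Y \<subseteq> X \<Longrightarrow> An (cut_in G X) v \<subseteq> An (cut_in G Y) v"
  by (auto simp: An_def cut_in_def elim!: rtrancl_mono[THEN subsetD, rotated])

lemma An_cut_in_subset: "An (cut_in G X) v \<subseteq> An G v"
  by (auto simp: An_def cut_in_def elim!: rtrancl_mono[THEN subsetD, rotated])

lemma An_cut_out_subset: "An (cut_out G X) v \<subseteq> An G v"
  by (auto simp: An_def cut_out_def elim!: rtrancl_mono[THEN subsetD, rotated])

lemma An_antisym:
  assumes "causal_diagram G" "a \<in> An G b" "b \<in> An G a"
  shows "a = b"
  using assms acyclic_impl_antisym_rtrancl[of "dir G"]
  by (auto simp: causal_diagram_def An_def antisym_def)

lemma An_trans: "a \<in> An G b \<Longrightarrow> b \<in> An G c \<Longrightarrow> a \<in> An G c"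
  by (auto simp: An_def)

text \<open>A nontrivial path to \<open>V\<close> starts with an edge leaving \<open>W\<close>, and
  such an edge survives the cut only if \<open>W\<close> lies outside \<open>X\<close>.\<close>

lemma An_cut_out_notin:
  assumes "W \<in> An (cut_out G X) V" "V \<notin> X"
  shows "W \<notin> X"
  using assms unfolding An_def cut_out_def
  by (auto elim: converse_rtranclE)

lemma wf_dir: "causal_diagram G \<Longrightarrow> wf (dir G)"
  unfolding causal_diagram_def by (metis finite_SigmaI finite_acyclic_wf finite_subset)

lemma not_self_edge: "causal_diagram G \<Longrightarrow> (v, v) \<notin> dir G"
  by (auto simp: causal_diagram_def acyclic_def)

lemma mem_ctf_An_iff:
  "(W, t) \<in> ctf_An G Q \<longleftrightarrow>
   (\<exists>Y x. (Y, x) \<in> Q \<and> W \<in> An (cut_out G (dom x)) Y \<and> t = x |` An (cut_in G (dom x)) W)"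
  unfolding ctf_An_def UN_iff Bex_def split_paired_Ex prod.case image_iff by auto

lemma ctf_AnI:
  "(Y, x) \<in> Q \<Longrightarrow> W \<in> An (cut_out G (dom x)) Y \<Longrightarrow>
   (W, x |` An (cut_in G (dom x)) W) \<in> ctf_An G Q"
  unfolding mem_ctf_An_iff by blast

section \<open>Solutions of acyclic systems\<close>

text \<open>Well-founded recursion along the edges yields a solution and induction makes it unique,
  so the definite description in \<open>solution\<close> denotes and can be unfolded once at a
  vertex.\<close>

lemma solution_eq:
  assumes G: "causal_diagram G"
    and F: "\<And>v s s'. v \<in> verts G \<Longrightarrow> (\<forall>w\<in>parents G v. s w = s' w) \<Longrightarrow> F v s = F v s'"
    and v: "v \<in> verts G"
  shows "solution (verts G) F v = F v (solution (verts G) F)"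
proof -
  let ?P = "\<lambda>s. s \<in> extensional (verts G) \<and> (\<forall>v\<in>verts G. s v = F v s)"
  have par: "w \<in> verts G" if "w \<in> parents G u" for w u
    using that G by (auto simp: parents_def causal_diagram_def)
  define h where "h = wfrec (dir G) (\<lambda>f v. F v f)"
  have h: "h u = F u h" if "u \<in> verts G" for u
    unfolding h_def
    by (subst wfrec[OF wf_dir[OF G]]) (auto intro!: F[OF that] simp: cut_def parents_def)
  \<comment> \<open>Truncating \<open>h\<close> to the vertices changes no equation, because parents
    are vertices.\<close>
  have ex: "?P (restrict h (verts G))"
    using h F[of _ h "restrict h (verts G)"] par by auto
  have "s = s'" if s: "?P s" and s': "?P s'" for s s'
  proof (rule extensionalityI[of _ "verts G"])
    show "s u = s' u" if "u \<in> verts G" for u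
      using wf_dir[OF G] that
    proof (induction u rule: wf_induct_rule)
      case (less u)
      then have "F u s = F u s'"
        using par by (intro F) (auto simp: parents_def)
      with less.prems s s' show ?case by simp
    qed
  qed (use s s' in auto)
  with ex have "\<exists>!s. ?P s" by blast
  from theI'[OF this] v show ?thesis
    by (simp add: solution_def)
qed

lemma potential_value_eq:
  assumes "causal_diagram G" "compatible M G" "v \<in> verts G"
  shows "potential_value M G (v, x) u =
    (case x v of Some a \<Rightarrow> a | None \<Rightarrow> mech M v (\<lambda>w. potential_value M G (w, x) u) (u v))"
  unfolding potential_value_def fst_conv snd_conv
  by (subst solution_eq[OF assms(1) _ assms(3)])
    (use assms(2) in \<open>auto simp: compatible_def split: option.split\<close>)

text \<open>Mechanism and noise of \<open>W\<close> are invisible to a response when the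
  intervention blocks every directed path from \<open>W\<close>. The alternative
  \<open>v \<in> dom x\<close> keeps the induction going at fixed parents, which may themselves
  descend from \<open>W\<close>.\<close>

lemma potential_value_cong:
  assumes G: "causal_diagram G" and M: "compatible M G" and N: "compatible N G"
    and mech: "\<And>v. v \<in> verts G \<Longrightarrow> v \<noteq> W \<Longrightarrow> mech M v = mech N v"
    and exo: "\<And>v. v \<in> verts G \<Longrightarrow> v \<noteq> W \<Longrightarrow> u v = u' v"
    and v: "v \<in> verts G" "v \<in> dom x \<or> W \<notin> An (cut_out G (dom x)) v"
  shows "potential_value M G (v, x) u = potential_value N G (v, x) u'"
  using wf_dir[OF G] v
proof (induction v rule: wf_induct_rule)
  case (less v)
  show ?case
  proof (cases "x v")
    case None
    then have vW: "v \<noteq> W" and W: "W \<notin> An (cut_out G (dom x)) v"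
      using less.prems An_refl by auto
    have "potential_value M G (w, x) u = potential_value N G (w, x) u'" if w: "w \<in> parents G v" for w
    proof (rule less.IH)
      from w show e: "(w, v) \<in> dir G" by (simp add: parents_def)
      with G show "w \<in> verts G" by (auto simp: causal_diagram_def)
      have "w \<in> An (cut_out G (dom x)) v" if "w \<notin> dom x"
        using An_cut_out_edge[OF An_refl e that] .
      then show "w \<in> dom x \<or> W \<notin> An (cut_out G (dom x)) w"
        using W by (blast intro: An_trans)
    qed
    then have "mech N v (\<lambda>w. potential_value M G (w, x) u) (u' v) =
      mech N v (\<lambda>w. potential_value N G (w, x) u') (u' v)"
      using N less.prems(1) by (auto simp: compatible_def)
    with None less.prems(1) mech[OF _ vW] exo[OF _ vW] show ?thesis
      by (simp add: potential_value_eq[OF G M] potential_value_eq[OF G N])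
  qed (use less.prems(1) in
    \<open>simp add: potential_value_eq[OF G M] potential_value_eq[OF G N]\<close>)
qed


section \<open>The lower layers are contained in layer 2.5\<close>

text \<open>Walk backwards from \<open>V\<close>: a vertex of \<open>dom x - {V}\<close> met on the
  way would be a relevant ancestor, hence fixed by \<open>y\<close>, and then the edge leaving it
  would have been cut.\<close>

lemma layer_2_25_step:
  assumes h: "\<And>X. X \<in> dom x - {V} \<Longrightarrow> X \<in> An (cut_in G (dom x - {V})) V \<Longrightarrow> X \<in> dom y"
    and W: "W \<in> An (cut_out G (dom y)) V"
  shows "W \<in> An (cut_in G (dom x - {V})) V \<and> W \<notin> dom x - {V}"
  using W unfolding An_def[of "cut_out _ _"] mem_Collect_eq
proof (induction rule: converse_rtrancl_induct)
  case base
  then show ?case by (simp add: An_refl)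
next
  case (step a b)
  then have ab: "(a, b) \<in> dir G" "a \<notin> dom y"
    by (auto simp: cut_out_def)
  with step.IH have "a \<in> An (cut_in G (dom x - {V})) V"
    by (auto simp: An_def cut_in_def intro: converse_rtrancl_into_rtrancl)
  with ab h show ?case by blast
qed

lemma layer_2_25_subset_layer_2_5:
  assumes G: "causal_diagram G" and Q: "in_layer L2_25 G Q"
  shows "in_layer L2_5 G Q"
proof -
  from Q obtain x where inj: "inj_on fst Q"
    and x: "\<And>V y. (V, y) \<in> Q \<Longrightarrow> y \<subseteq>\<^sub>m x \<and> V \<notin> dom y \<and>
      (\<forall>X\<in>dom x - {V}. X \<in> An (cut_in G (dom x - {V})) V \<longrightarrow> y X = x X)"
    unfolding in_layer_def in_layer_shape.simps by (elim conjE exE) fast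
  have h: "X \<in> dom y" if "(V, y) \<in> Q" "X \<in> dom x - {V}" "X \<in> An (cut_in G (dom x - {V})) V" for V y X
    using x[OF that(1)] that by force
  have sub: "dom y \<subseteq> dom x" if "(V, y) \<in> Q" for V y
    using x[OF that] by (auto simp: map_le_implies_dom_le)
  \<comment> \<open>The two responses play symmetric roles, so one inclusion between the restricted
    subscripts suffices.\<close>
  have half: "(y' |` An (cut_in G (dom y')) W) z = Some c"
    if Vy: "(V, y) \<in> Q" "W \<in> An (cut_out G (dom y)) V"
      and Vy': "(V', y') \<in> Q" "W \<in> An (cut_out G (dom y')) V'"
      and z: "(y |` An (cut_in G (dom y)) W) z = Some c"
    for V y V' y' W z c
  \<comment> \<open>If \<open>x\<close> acts on \<open>W\<close>, then \<open>W\<close> can only be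
    the response variable itself, and each variable has at most one response.\<close>
  proof (cases "W \<in> dom x")
    case True
    with layer_2_25_step[OF h[OF Vy(1)] Vy(2)] layer_2_25_step[OF h[OF Vy'(1)] Vy'(2)]
    have "W = V" "W = V'" by auto
    with inj_onD[OF inj, of "(V, y)" "(V', y')"] Vy(1) Vy'(1) have "y = y'" by simp
    with z show ?thesis by simp
  next
    case False
    note W = layer_2_25_step[OF h[OF Vy(1)] Vy(2)] and W' = layer_2_25_step[OF h[OF Vy'(1)] Vy'(2)]
    from z have zy: "y z = Some c" and zA: "z \<in> An (cut_in G (dom y)) W"
      by (auto simp: restrict_map_def split: if_splits)
    \<comment> \<open>The second conjunct drives the induction: an edge of
      \<open>cut_in G (dom y)\<close> enters a vertex outside \<open>dom y\<close>, hence outside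
      \<open>dom x\<close>, so it also survives the larger cut.\<close>
    have "z \<in> An (cut_in G (dom x)) W \<and> (z \<notin> dom y \<longrightarrow> z \<notin> dom x)"
      using zA unfolding An_def[of "cut_in G (dom y)"] mem_Collect_eq
    proof (induction rule: converse_rtrancl_induct)
      case base
      then show ?case using False by (simp add: An_refl)
    next
      case (step a b)
      then have ab: "(a, b) \<in> dir G" and b: "b \<notin> dom x"
        by (auto simp: cut_in_def)
      with step.IH have a: "a \<in> An (cut_in G (dom x)) W"
        by (auto simp: An_def cut_in_def intro: converse_rtrancl_into_rtrancl)
      have aV: "a \<in> An (cut_in G (dom x - {V})) V"
        by (rule An_trans[OF subsetD[OF An_cut_in_antimono a] conjunct1[OF W]]) blast
      have "a \<noteq> V" if "a \<in> dom x"
      proof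
        assume "a = V"
        with An_antisym[OF G subsetD[OF An_cut_in_subset a]] W An_cut_in_subset
        have "a = W" by blast
        with that False show False by simp
      qed
      with aV h[OF Vy(1), of a] have "a \<notin> dom y \<longrightarrow> a \<notin> dom x" by blast
      with a show ?case by blast
    qed
    then have z': "z \<in> An (cut_in G (dom x)) W" by blast
    have zx: "z \<in> dom x" "x z = Some c"
      using zy x[OF Vy(1)] by (force simp: map_le_def)+
    have "z \<noteq> V'"
    proof
      assume "z = V'"
      with An_antisym[OF G subsetD[OF An_cut_in_subset z']] W' An_cut_in_subset
      have "z = W" by blast
      with zx False show False by simp
    qed
    moreover have "z \<in> An (cut_in G (dom x - {V'})) V'"
      by (rule An_trans[OF subsetD[OF An_cut_in_antimono z'] conjunct1[OF W']]) blast
    ultimately have "y' z = Some c"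
      using x[OF Vy'(1)] zx by auto
    moreover have "z \<in> An (cut_in G (dom y')) W"
      using z' An_cut_in_antimono[OF sub[OF Vy'(1)]] by blast
    ultimately show ?thesis by simp
  qed
  have "t = s" if ts: "(W, t) \<in> ctf_An G Q" "(W, s) \<in> ctf_An G Q" for W t s
  proof -
    have "t z = Some c \<longleftrightarrow> s z = Some c" for z c
      using ts half unfolding mem_ctf_An_iff by blast
    then show ?thesis by (metis ext not_Some_eq)
  qed
  with Q show ?thesis by (auto simp: in_layer_def)
qed

lemma layer_2_subset_layer_2_5:
  assumes "in_layer L2 G Q"
  shows "in_layer L2_5 G Q"
proof -
  from assms obtain x where "\<And>Y y. (Y, y) \<in> Q \<Longrightarrow> y = x"
    by (auto simp: in_layer_def)
  then have "t = x |` An (cut_in G (dom x)) W" if "(W, t) \<in> ctf_An G Q" for W t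
    using that unfolding mem_ctf_An_iff by blast
  with assms show ?thesis by (simp add: in_layer_def) blast
qed

lemma layer_1_subset_layer_2: "in_layer L1 G Q \<Longrightarrow> in_layer L2 G Q"
  by (auto simp: in_layer_def)

lemma layer_subset_layer_2_5:
  assumes "causal_diagram G" "in_layer j G Q" "j \<noteq> L3"
  shows "in_layer L2_5 G Q"
  using assms
  by (cases j) (blast intro: layer_1_subset_layer_2 layer_2_subset_layer_2_5
      layer_2_25_subset_layer_2_5)+

text \<open>Positivity and agreement on a larger layer imply both on a smaller one, so
  identifiability is preserved when the data grow.\<close>

lemma identifiable_from_layer_2_5:
  assumes "causal_diagram G" "identifiable_from_layer G j Q" "j \<noteq> L3"
  shows "identifiable_from_layer G L2_5 Q"
proof -
  have "layer_positive j G M" if "layer_positive L2_5 G M" for M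
    using that layer_subset_layer_2_5[OF assms(1) _ assms(3)]
    unfolding layer_positive_def by blast
  moreover have "layer_agree j G M N" if "layer_agree L2_5 G M N" for M N
    using that layer_subset_layer_2_5[OF assms(1) _ assms(3)]
    unfolding layer_agree_def by blast
  ultimately show ?thesis
    using assms(2) unfolding identifiable_from_layer_def identifiable_def by blast
qed

section \<open>Locating a conflict at a single edge\<close>

lemma layer_2_5_conflict:
  assumes G: "causal_diagram G" and wf: "wf_query G Q" and Q: "\<not> in_layer L2_5 G Q"
  obtains Y x Y' x' P W a where "(Y, x) \<in> Q" "(Y', x') \<in> Q" "(P, W) \<in> dir G"
    "W \<in> An (cut_out G (dom x)) Y" "W \<in> An (cut_out G (dom x')) Y'"
    "x P = Some a" "x' P \<noteq> Some a"
proof -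
  note conflict = that
  have wfQ: "Y \<notin> dom x" if "(Y, x) \<in> Q" for Y x
    using wf that by (auto simp: wf_query_def)
  let ?sub = "\<lambda>x W. x |` An (cut_in G (dom x)) W"
  \<comment> \<open>The subscripts of \<open>W\<close> disagree at \<open>z\<close>. Let
    \<open>P\<close> precede \<open>W\<close> on a path from \<open>z\<close>. Either
    \<open>P\<close> is fixed differently by the two subscripts, or neither fixes it and the
    disagreement at \<open>z\<close> moves up to \<open>P\<close>.\<close>
  have *: thesis if "(Y, x) \<in> Q" "(Y', x') \<in> Q"
      "W \<in> An (cut_out G (dom x)) Y" "W \<in> An (cut_out G (dom x')) Y'"
      "?sub x W z = Some c" "?sub x' W z \<noteq> Some c" for W Y x Y' x' z c
    using wf_dir[OF G] that
  proof (induction W arbitrary: Y x Y' x' rule: wf_induct_rule)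
    case (less W)
    note Q = less.prems(1,2) and W = less.prems(3,4)
    have W_notin: "W \<notin> dom x" "W \<notin> dom x'"
      using An_cut_out_notin W wfQ Q by blast+
    have xz: "x z = Some c" and z: "z \<in> An (cut_in G (dom x)) W"
      using less.prems(5) by (auto simp: restrict_map_def split: if_splits)
    have "z \<noteq> W" using xz W_notin by auto
    with z obtain P where zP: "(z, P) \<in> (dir (cut_in G (dom x)))\<^sup>*"
      and "(P, W) \<in> dir (cut_in G (dom x))"
      unfolding An_def mem_Collect_eq by (blast elim: rtranclE)
    then have PW: "(P, W) \<in> dir G" by (simp add: cut_in_def)
    show thesis
    proof (cases "P = z")
      case True
      then have "x' P \<noteq> Some c"
        using less.prems(6) An_cut_in_edge[OF An_refl PW W_notin(2)]
        by (auto simp: restrict_map_def)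
      with True xz conflict[OF Q PW W] show thesis by blast
    next
      case False
      with zP have P: "P \<notin> dom x" by (auto simp: cut_in_def elim: rtranclE)
      show thesis
      proof (cases "x' P")
        \<comment> \<open>Here only \<open>x'\<close> fixes \<open>P\<close>, so the two responses
          exchange roles.\<close>
        case (Some b)
        with P conflict[OF Q(2,1) PW W(2,1), of b] show thesis by auto
      next
        case None
        then have P': "P \<notin> dom x'" by auto
        show thesis
        proof (rule less.IH[OF PW Q An_cut_out_edge[OF W(1) PW P] An_cut_out_edge[OF W(2) PW P']])
          show "?sub x P z = Some c" using zP xz by (auto simp: An_def)
          show "?sub x' P z \<noteq> Some c"
            using less.prems(6) An_cut_in_edge[OF _ PW W_notin(2)]
            by (auto simp: restrict_map_def)
        qed
      qed
    qed
  qed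
  from Q wf obtain W t s where "(W, t) \<in> ctf_An G Q" "(W, s) \<in> ctf_An G Q" "t \<noteq> s"
    by (auto simp: in_layer_def)
  moreover have "\<exists>z c. t z = Some c \<and> s z \<noteq> Some c \<or> s z = Some c \<and> t z \<noteq> Some c"
    using \<open>t \<noteq> s\<close> by (metis ext not_Some_eq)
  ultimately show thesis
    using * unfolding mem_ctf_An_iff by blast
qed


section \<open>Two models separating a conflicting query\<close>

text \<open>Independence of coordinate blocks is available for product sigma-algebras; over finitely
  many countable coordinates these are discrete, as \<open>compatible\<close> demands.\<close>

lemma exogenous_Pi_pmf_indep:
  fixes p :: "var \<Rightarrow> nat pmf"
  assumes V: "finite V" and AB: "A \<subseteq> V" "B \<subseteq> V" "A \<inter> B = {}"
  shows "prob_space.indep_var (measure_pmf (Pi_pmf V d p))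
    (count_space UNIV) (\<lambda>u. restrict u A) (count_space UNIV) (\<lambda>u. restrict u B)"
proof -
  have fin: "finite A" "finite B" using V AB by (auto intro: finite_subset)
  have "prob_space.indep_var (measure_pmf (Pi_pmf V d p)) (Pi\<^sub>M A (\<lambda>_. count_space UNIV))
      (\<lambda>u. restrict u A) (Pi\<^sub>M B (\<lambda>_. count_space UNIV)) (\<lambda>u. restrict u B)"
    using prob_space.indep_var_restrict[OF measure_pmf.prob_space_axioms
        indep_vars_Pi_pmf[OF V, of d p] AB(3,1,2)]
    by simp
  then have "prob_space.indep_var (measure_pmf (Pi_pmf V d p)) (count_space UNIV)
      ((\<lambda>f. f) \<circ> (\<lambda>u. restrict u A)) (count_space UNIV) ((\<lambda>f. f) \<circ> (\<lambda>u. restrict u B))"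
    by (rule prob_space.indep_var_compose[OF measure_pmf.prob_space_axioms])
      (simp_all add: count_space_PiM_finite fin)
  then show ?thesis by (simp add: o_def)
qed

text \<open>
  Noise values up to \<open>K\<close> fix the vertex to a constant, which makes all distributions positive; above
  \<open>K\<close>, vertices pass on the signal value \<open>K\<close> from any parent. At \<open>W\<close> the noise values
  \<open>K + 1\<close> and \<open>K + 2\<close> decide whether the signal is emitted. The twisted model exchanges
  their roles unless \<open>P\<close> has the value \<open>a\<close>: the kernel of \<open>W\<close> given \<open>P\<close> does not change,
  but the coupling of its responses to \<open>a\<close> and to other values does.
\<close>

locale conflict_models =
  fixes G :: diagram and P W :: var and K a :: val
  assumes G: "causal_diagram G" and PW: "(P, W) \<in> dir G" and K: "2 \<le> K" and a: "a < K"
begin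

definition swap :: "nat \<Rightarrow> nat" where
  "swap = Transposition.transpose (K + 1) (K + 2)"

definition emit :: "nat \<Rightarrow> val" where
  "emit e = (if e \<le> K then e else if e = K + 1 then K else 0)"

text \<open>Coordinates outside the diagram are pinned to 0, which makes the set finite and its
  uniform law a product \<open>Pi_pmf\<close> with default 0.\<close>

definition noise :: "(var \<Rightarrow> nat) set" where
  "noise = PiE_dflt (verts G) 0 (\<lambda>_. {..K + 2})"

definition model :: "bool \<Rightarrow> scm" where
  "model twisted = \<lparr>
     vals = (\<lambda>_. {..K}),
     mech = (\<lambda>v p e.
       if v = P then min e K
       else if v = W then emit (if twisted \<and> p P \<noteq> a then swap e else e)
       else if e \<le> K then e else if \<exists>w\<in>parents G v. p w = K then K else 0),
     exo = pmf_of_set noise\<rparr>"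

lemma model_simps:
  "vals (model b) v = {..K}"
  "mech (model b) v p e =
    (if v = P then min e K
     else if v = W then emit (if b \<and> p P \<noteq> a then swap e else e)
     else if e \<le> K then e else if \<exists>w\<in>parents G v. p w = K then K else 0)"
  "exo (model b) = pmf_of_set noise"
  by (simp_all add: model_def)

text \<open>The value of \<open>P\<close> under \<open>x\<close>. As \<open>P\<close> ignores its
  parents in both models, only the noise of \<open>P\<close> matters, and changing the noise of
  \<open>W\<close> leaves it alone.\<close>

definition input :: "(var \<rightharpoonup> val) \<Rightarrow> (var \<Rightarrow> nat) \<Rightarrow> val" where
  "input x u = (case x P of Some b \<Rightarrow> b | None \<Rightarrow> min (u P) K)"

definition twist :: "(var \<rightharpoonup> val) \<Rightarrow> (var \<Rightarrow> nat) \<Rightarrow> var \<Rightarrow> nat" where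
  "twist x u = (if input x u \<noteq> a then u(W := swap (u W)) else u)"

lemma P_neq_W: "P \<noteq> W"
  using PW not_self_edge[OF G] by auto

lemma PW_verts: "P \<in> verts G" "W \<in> verts G"
  using PW G by (auto simp: causal_diagram_def)

lemma finite_noise: "finite noise"
  using G by (auto simp: noise_def causal_diagram_def intro!: finite_PiE_dflt)

lemma noise_nonempty: "noise \<noteq> {}"
proof -
  have "(\<lambda>_. 0) \<in> noise" by (simp add: noise_def PiE_dflt_def)
  then show ?thesis by blast
qed

lemma compatible_model: "compatible (model b) G"
  unfolding compatible_def
proof (intro conjI allI ballI impI)
  fix v e and p q :: "var \<Rightarrow> val"
  assume eq: "\<forall>w\<in>parents G v. p w = q w"
  then have "(\<exists>w\<in>parents G v. p w = K) = (\<exists>w\<in>parents G v. q w = K)" by auto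
  moreover have "p P = q P" if "v = W"
    using eq PW that by (auto simp: parents_def)
  ultimately show "mech (model b) v p e = mech (model b) v q e"
    by (cases "v = W") (simp_all add: model_simps)
next
  fix A B assume "A \<subseteq> verts G" "B \<subseteq> verts G" "A \<inter> B = {}"
  moreover have "exo (model b) = Pi_pmf (verts G) 0 (\<lambda>_. pmf_of_set {..K + 2})"
    using G by (simp add: model_simps noise_def causal_diagram_def Pi_pmf_of_set)
  ultimately show "prob_space.indep_var (measure_pmf (exo (model b)))
      (count_space UNIV) (\<lambda>u. restrict u A) (count_space UNIV) (\<lambda>u. restrict u B)"
    using G by (simp add: causal_diagram_def exogenous_Pi_pmf_indep)
qed (auto simp: model_simps emit_def)

section \<open>Positivity of both models\<close>

lemmas value_eq = potential_value_eq[OF G compatible_model]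

lemma value_constant:
  assumes "Y \<in> verts G" "Y \<notin> dom x" "u Y \<le> K"
  shows "potential_value (model b) G (Y, x) u = u Y"
proof -
  have "swap (u Y) = u Y" using assms(3) by (simp add: swap_def Transposition.transpose_def)
  with assms show ?thesis
    by (subst value_eq) (auto simp: model_simps emit_def split: option.split)
qed

lemma value_P: "potential_value (model b) G (P, x) u = input x u"
  using PW_verts by (subst value_eq) (auto simp: model_simps input_def split: option.split)

text \<open>Noise values up to \<open>K\<close> override the parents, so any prescribed tuple is
  produced by using it as noise. Injectivity of \<open>fst\<close> prevents two demands on one
  vertex.\<close>

lemma layer_positive_model: "layer_positive j G (model b)"
  unfolding layer_positive_def
proof (intro allI impI ballI)
  fix Z z
  assume Z: "in_layer j G Z" and inj: "inj_on fst Z" and "z \<in> (\<Pi>\<^sub>E r\<in>Z. vals (model b) (fst r))"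
  then have z: "z \<in> Z \<rightarrow>\<^sub>E {..K}" by (simp add: model_simps)
  define u where "u v = (if v \<in> fst ` Z then z (inv_into Z fst v) else 0)" for v
  have wf: "Y \<in> verts G" "Y \<notin> dom x" if "(Y, x) \<in> Z" for Y x
    using Z that by (auto simp: in_layer_def wf_query_def)
  have u: "u (fst r) = z r" if "r \<in> Z" for r
    using that inj by (simp add: u_def)
  have "u \<in> noise"
    using z wf u by (fastforce simp: noise_def PiE_dflt_def PiE_def Pi_def u_def)
  have "(\<lambda>r\<in>Z. potential_value (model b) G r u) = z"
  proof (rule extensionalityI[of _ Z])
    fix r assume r: "r \<in> Z"
    obtain Y x where "r = (Y, x)" by fastforce
    moreover have "z r \<le> K" using z r by auto
    ultimately show "(\<lambda>r\<in>Z. potential_value (model b) G r u) r = z r"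
      using value_constant[of Y x u b] wf[of Y x] u[OF r] r by simp
  qed (use z in \<open>simp_all add: PiE_def\<close>)
  with \<open>u \<in> noise\<close> have "z \<in> set_pmf (ctf_dist (model b) G Z)"
    by (force simp: ctf_dist_def model_simps finite_noise noise_nonempty)
  then show "pmf (ctf_dist (model b) G Z) z > 0"
    by (simp add: pmf_positive_iff)
qed

section \<open>Agreement of the models on layer 2.5\<close>

lemma swap_swap [simp]: "swap (swap e) = e"
  by (simp add: swap_def)

lemma input_upd: "input x (u(W := e)) = input x u"
  using P_neq_W by (auto simp: input_def split: option.split)

lemma twist_twist [simp]: "twist x (twist x u) = u"
  by (auto simp: twist_def input_upd)

lemma twist_noise: "u \<in> noise \<Longrightarrow> twist x u \<in> noise"
  using PW_verts by (auto simp: twist_def noise_def PiE_dflt_def swap_def Transposition.transpose_def)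

lemma bij_twist: "bij_betw (twist x) noise noise"
  by (rule bij_betw_byWitness[where f' = "twist x"]) (auto intro: twist_noise)

text \<open>The mechanism of \<open>W\<close> swaps its noise exactly when the value of
  \<open>P\<close>, namely \<open>input x u\<close>, differs from \<open>a\<close>; the swap can
  therefore be applied to the noise vector beforehand.\<close>

lemma twisted_value:
  assumes "W \<notin> dom x" "v \<in> verts G"
  shows "potential_value (model True) G (v, x) u = potential_value (model False) G (v, x) (twist x u)"
  using wf_dir[OF G] assms(2)
proof (induction v rule: wf_induct_rule)
  case (less v)
  let ?p = "\<lambda>w. potential_value (model True) G (w, x) u"
  let ?q = "\<lambda>w. potential_value (model False) G (w, x) (twist x u)"
  have "?p w = ?q w" if "w \<in> parents G v" for w
    using that less.IH G by (auto simp: parents_def causal_diagram_def)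
  moreover have "twist x u v = u v" if "v \<noteq> W"
    using that by (simp add: twist_def)
  moreover have "(if ?p P \<noteq> a then swap (u W) else u W) = twist x u W"
    by (simp add: value_P twist_def)
  ultimately have "mech (model True) v ?p (u v) = mech (model False) v ?q (twist x u v)"
    using P_neq_W by (auto simp: model_simps)
  with less.prems show ?case
    by (simp add: value_eq split: option.split)
qed

lemma layer_agree_models: "layer_agree L2_5 G (model True) (model False)"
  unfolding layer_agree_def
proof (intro allI impI)
  fix Z assume Z: "in_layer L2_5 G Z"
  have wf: "Y \<in> verts G" "Y \<notin> dom x" if "(Y, x) \<in> Z" for Y x
    using Z that by (auto simp: in_layer_def wf_query_def)
  define reads where "reads Y x \<longleftrightarrow> (Y, x) \<in> Z \<and> W \<in> An (cut_out G (dom x)) Y" for Y x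
  \<comment> \<open>\<open>P\<close> is a parent of the unfixed vertex \<open>W\<close>, so it
    survives the restriction of both subscripts to ancestors of \<open>W\<close>, which layer 2.5
    makes equal.\<close>
  have same: "x P = x' P" if "reads Y x" "reads Y' x'" for Y x Y' x'
  proof -
    have P: "P \<in> An (cut_in G (dom x)) W" if "reads Y x" for Y x
    proof (rule An_cut_in_edge[OF An_refl PW])
      from that have "(Y, x) \<in> Z" "W \<in> An (cut_out G (dom x)) Y" by (auto simp: reads_def)
      then show "W \<notin> dom x" using An_cut_out_notin wf(2) by blast
    qed
    have "x |` An (cut_in G (dom x)) W = x' |` An (cut_in G (dom x')) W"
      using that Z ctf_AnI[of _ _ Z W G] unfolding reads_def in_layer_def in_layer_shape.simps
      by metis
    from fun_cong[OF this, of P] show ?thesis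
      using P that by simp
  qed
  \<comment> \<open>One twist serves all responses that read \<open>W\<close>; if none does, any
    \<open>x0\<close> will do. Since the twist permutes \<open>noise\<close>, it preserves the
    uniform law.\<close>
  obtain x0 where x0: "\<And>Y x. reads Y x \<Longrightarrow> x P = x0 P"
    using same by (cases "\<exists>Y x. reads Y x") blast+
  have "potential_value (model True) G r u = potential_value (model False) G r (twist x0 u)"
    if "r \<in> Z" for r u
  proof -
    obtain Y x where r: "r = (Y, x)" by fastforce
    show ?thesis
    proof (cases "W \<in> An (cut_out G (dom x)) Y")
      case True
      with r that have "reads Y x" by (simp add: reads_def)
      from x0[OF this] have "twist x u = twist x0 u" by (simp add: twist_def input_def)
      with twisted_value[of x Y u] show ?thesis
        using True An_cut_out_notin wf that r by auto
    next
      case False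
      then show ?thesis unfolding r
        by (intro potential_value_cong[OF G compatible_model compatible_model, where W = W])
          (use that wf r in \<open>auto simp: model_simps twist_def fun_eq_iff\<close>)
    qed
  qed
  then have "ctf_dist (model True) G Z =
      map_pmf (\<lambda>u. \<lambda>r\<in>Z. potential_value (model False) G r u)
        (map_pmf (twist x0) (exo (model True)))"
    by (auto simp: ctf_dist_def map_pmf_comp intro!: map_pmf_cong restrict_ext)
  also have "map_pmf (twist x0) (exo (model True)) = exo (model False)"
    using map_pmf_of_set_bij_betw[OF bij_twist noise_nonempty finite_noise] by (simp add: model_simps)
  finally show "ctf_dist (model True) G Z = ctf_dist (model False) G Z"
    by (simp add: ctf_dist_def restrict_def)
qed

section \<open>Propagation of the signal in the untwisted model\<close>

lemma signal_mono:
  assumes "v \<in> verts G" "u W = K + 2" "potential_value (model False) G (v, x) u = K"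
  shows "potential_value (model False) G (v, x) (u(W := K + 1)) = K"
  using wf_dir[OF G] assms(1,3)
proof (induction v rule: wf_induct_rule)
  case (less v)
  let ?p = "\<lambda>w. potential_value (model False) G (w, x) u"
  let ?q = "\<lambda>w. potential_value (model False) G (w, x) (u(W := K + 1))"
  have "?q w = K" if "w \<in> parents G v" "?p w = K" for w
  proof -
    from that(1) G have "(w, v) \<in> dir G" "w \<in> verts G"
      by (auto simp: parents_def causal_diagram_def)
    from less.IH[OF this that(2)] show ?thesis .
  qed
  \<comment> \<open>At \<open>W\<close> the premise fails because \<open>emit (K + 2) = 0\<close>;
    \<open>P\<close> keeps its noise; all other vertices are monotone in the set of parents carrying
    \<open>K\<close>.\<close>
  then have "mech (model False) v ?p (u v) = K \<longrightarrow>
      mech (model False) v ?q ((u(W := K + 1)) v) = K"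
    using P_neq_W by (auto simp: model_simps emit_def)
  with less.prems show ?case
    by (cases "x v") (simp_all add: value_eq del: fun_upd_apply)
qed

text \<open>No source of \<open>K\<close> is left: \<open>W\<close> emits 0, \<open>P\<close> and
  all assigned values lie below \<open>K\<close>, and every other unfixed vertex merely
  relays.\<close>

lemma no_signal:
  assumes "v \<in> verts G" "u W = K + 2" "u P < K" "\<And>b. b \<in> ran x \<Longrightarrow> b < K"
    and "\<And>v. v \<in> verts G \<Longrightarrow> v \<noteq> P \<Longrightarrow> K < u v"
  shows "potential_value (model False) G (v, x) u \<noteq> K"
  using wf_dir[OF G] assms(1)
proof (induction v rule: wf_induct_rule)
  case (less v)
  let ?p = "\<lambda>w. potential_value (model False) G (w, x) u"
  have "?p w \<noteq> K" if "w \<in> parents G v" for w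
    using that less.IH G by (auto simp: parents_def causal_diagram_def)
  then have "mech (model False) v ?p (u v) \<noteq> K"
    using assms(2,3) assms(5)[of v] less.prems K by (auto simp: model_simps emit_def)
  moreover have "b \<noteq> K" if "x v = Some b" for b
    using assms(4)[of b] that by (auto simp: ran_def)
  ultimately show ?case
    using less.prems by (simp add: value_eq split: option.splits)
qed

text \<open>On an uncut path from \<open>W\<close> no vertex is fixed, and by acyclicity none after
  \<open>W\<close> is \<open>P\<close> or \<open>W\<close>; so each has noise above \<open>K\<close>
  and relays the signal.\<close>

lemma signal_arrives:
  assumes "W \<in> An (cut_out G (dom x)) Y" "Y \<notin> dom x" "u W = K + 1"
    and "\<And>v. v \<in> verts G \<Longrightarrow> v \<noteq> P \<Longrightarrow> K < u v" "Y \<in> verts G"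
  shows "potential_value (model False) G (Y, x) u = K"
  using assms(1,2) unfolding An_def mem_Collect_eq
proof (induction rule: rtrancl_induct)
  case base
  with PW_verts P_neq_W assms(3) show ?case
    by (subst value_eq) (auto simp: model_simps emit_def split: option.split)
next
  case (step v w)
  from step.hyps(2) have e: "(v, w) \<in> dir G" and "v \<notin> dom x" by (auto simp: cut_out_def)
  with step.IH have v: "potential_value (model False) G (v, x) u = K" by blast
  have Wv: "W \<in> An G v"
    using step.hyps(1) An_cut_out_subset by (auto simp: An_def)
  then have "W \<in> An G w" using e by (auto simp: An_def)
  then have "w \<noteq> P"
    using PW P_neq_W An_antisym[OF G, of P W] by (auto simp: An_def)
  moreover have "w \<noteq> W"
    using e Wv An_antisym[OF G, of v W] not_self_edge[OF G] by (auto simp: An_def)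
  moreover have "w \<in> verts G" using e G by (auto simp: causal_diagram_def)
  moreover have "v \<in> parents G w" using e by (simp add: parents_def)
  ultimately show ?case
    using v assms(4)[of w] step.prems by (subst value_eq) (auto simp: model_simps split: option.split)
qed

text \<open>
  Pairing each noise vector with its twist turns the difference of the two joint frequencies into
  half a sum of products of increments; both increments have the same sign since signals are
  monotone.
\<close>

lemma joint_signal_differs:
  assumes Y: "Y \<in> verts G" "Y \<notin> dom x" "W \<in> An (cut_out G (dom x)) Y" "x P = Some a"
    and Y': "Y' \<in> verts G" "Y' \<notin> dom x'" "W \<in> An (cut_out G (dom x')) Y'" "x' P \<noteq> Some a"
    and small: "\<And>b. b \<in> ran x \<Longrightarrow> b < K" "\<And>b. b \<in> ran x' \<Longrightarrow> b < K"
  shows "card {u \<in> noise. potential_value (model True) G (Y, x) u = K \<and>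
           potential_value (model True) G (Y', x') u = K} \<noteq>
         card {u \<in> noise. potential_value (model False) G (Y, x) u = K \<and>
           potential_value (model False) G (Y', x') u = K}"
proof -
  define f where "f u = (of_bool (potential_value (model False) G (Y, x) u = K) :: int)" for u
  define g where "g u = (of_bool (potential_value (model False) G (Y', x') u = K) :: int)" for u
  define t where "t = twist x'"
  have W_notin: "W \<notin> dom x" "W \<notin> dom x'" using An_cut_out_notin Y Y' by blast+
  \<comment> \<open>The first response fixes \<open>P\<close> to \<open>a\<close>, so only the
    second one feels the twist.\<close>
  have "twist x u = u" for u using Y(4) by (simp add: twist_def input_def)
  then have "int (card {u \<in> noise. potential_value (model True) G (Y, x) u = K \<and>
      potential_value (model True) G (Y', x') u = K}) = (\<Sum>u\<in>noise. f u * g (t u))"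
    using twisted_value[OF W_notin(1) Y(1)] twisted_value[OF W_notin(2) Y'(1)] finite_noise
    by (simp add: f_def g_def t_def flip: of_bool_conj) (simp add: of_bool_def sum.If_cases Int_def)
  moreover have "int (card {u \<in> noise. potential_value (model False) G (Y, x) u = K \<and>
      potential_value (model False) G (Y', x') u = K}) = (\<Sum>u\<in>noise. f u * g u)"
    using finite_noise
    by (simp add: f_def g_def flip: of_bool_conj) (simp add: of_bool_def sum.If_cases Int_def)
  moreover have "(\<Sum>u\<in>noise. f u * g (t u)) < (\<Sum>u\<in>noise. f u * g u)"
  proof -
    have tt [simp]: "t (t u) = u" for u by (simp add: t_def)
    have bij: "bij_betw t noise noise" unfolding t_def by (rule bij_twist)
    have "(\<Sum>u\<in>noise. f (t u) * g (t u)) = (\<Sum>u\<in>noise. f u * g u)"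
      using sum.reindex_bij_betw[OF bij, of "\<lambda>u. f u * g u"] by simp
    moreover have "(\<Sum>u\<in>noise. f (t u) * g u) = (\<Sum>u\<in>noise. f u * g (t u))"
      using sum.reindex_bij_betw[OF bij, of "\<lambda>u. f u * g (t u)"] by simp
    ultimately have "2 * ((\<Sum>u\<in>noise. f u * g u) - (\<Sum>u\<in>noise. f u * g (t u))) =
        (\<Sum>u\<in>noise. (f u - f (t u)) * (g u - g (t u)))"
      by (simp add: algebra_simps sum.distrib sum_subtractf)
    moreover have "0 < (\<Sum>u\<in>noise. (f u - f (t u)) * (g u - g (t u)))"
    proof -
      have mono: "f u \<le> f (u(W := K + 1))" "g u \<le> g (u(W := K + 1))" if "u W = K + 2" for u
        using signal_mono[of Y u x] signal_mono[of Y' u x'] that Y(1) Y'(1)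
        by (simp_all add: f_def g_def)
      have nonneg: "0 \<le> (f u - f (t u)) * (g u - g (t u))" for u
      proof -
        have "t u = u \<or> u W = K + 2 \<and> t u = u(W := K + 1) \<or> u W = K + 1 \<and> t u = u(W := K + 2)"
          by (simp add: t_def twist_def swap_def Transposition.transpose_def)
        then consider "t u = u" | "u W = K + 2" "t u = u(W := K + 1)"
          | "u W = K + 1" "t u = u(W := K + 2)"
          by blast
        then show ?thesis
        proof cases
          case 2
          with mono[of u] show ?thesis by (simp add: mult_nonpos_nonpos)
        next
          case 3
          then have "(t u)(W := K + 1) = u" by auto
          with mono[of "t u"] 3 show ?thesis by simp
        qed simp
      qed
      \<comment> \<open>A value of \<open>P\<close> other than \<open>a\<close>; it lies below
        \<open>K\<close> because \<open>2 \<le> K\<close>.\<close>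
      define p where "p = (if a = 0 then 1 else 0 :: nat)"
      have p: "p \<noteq> a" "p < K" using K by (auto simp: p_def)
      \<comment> \<open>A strictly positive summand: \<open>W\<close> emits under \<open>u\<close>
        but not under \<open>t u\<close>, and all vertices except \<open>P\<close> and
        \<open>W\<close> relay, so both increments equal 1.\<close>
      define u where "u v = (if v \<notin> verts G then 0 else if v = P then p else K + 1)" for v
      have "u \<in> noise" using p by (auto simp: u_def noise_def PiE_dflt_def)
      have "input x' u \<noteq> a"
        using Y'(4) p PW_verts by (auto simp: input_def u_def split: option.split)
      then have tu: "t u = u(W := K + 2)"
        using PW_verts P_neq_W by (simp add: t_def twist_def u_def swap_def)
      have "f u = 1" "g u = 1"
        using signal_arrives[OF Y(3,2) _ _ Y(1)] signal_arrives[OF Y'(3,2) _ _ Y'(1)]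
          PW_verts P_neq_W by (simp_all add: f_def g_def u_def)
      moreover have "f (t u) = 0" "g (t u) = 0"
        using no_signal[OF Y(1) _ _ small(1), of "t u"] no_signal[OF Y'(1) _ _ small(2), of "t u"]
          PW_verts P_neq_W p by (simp_all add: tu f_def g_def u_def)
      ultimately show ?thesis
        using nonneg \<open>u \<in> noise\<close> finite_noise by (intro sum_pos2[where i = u]) auto
    qed
    ultimately show ?thesis by simp
  qed
  ultimately show ?thesis by linarith
qed

text \<open>All values in \<open>Q\<close> are below \<open>K\<close>, so no intervention injects a
  signal. The event that both responses equal \<open>K\<close> then tells the two laws
  apart.\<close>

lemma not_identifiable:
  assumes wf: "wf_query G Q" and over: "query_over (\<lambda>_. {..<K}) Q"
    and Q: "(Y, x) \<in> Q" "(Y', x') \<in> Q"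
    and W: "W \<in> An (cut_out G (dom x)) Y" "W \<in> An (cut_out G (dom x')) Y'"
    and P: "x P = Some a" "x' P \<noteq> Some a"
  shows "\<not> identifiable_from_layer G L2_5 Q"
proof
  assume "identifiable_from_layer G L2_5 Q"
  moreover have "query_over (vals (model b)) Q" for b
    using over by (force simp: query_over_def model_simps)
  moreover have "vals (model True) v = vals (model False) v" for v by (simp add: model_simps)
  ultimately have eq: "ctf_dist (model True) G Q = ctf_dist (model False) G Q"
    unfolding identifiable_from_layer_def identifiable_def
    using compatible_model layer_positive_model layer_agree_models by metis
  define E where "E b = {u \<in> noise. potential_value (model b) G (Y, x) u = K \<and>
           potential_value (model b) G (Y', x') u = K}" for b
  have "measure_pmf.prob (ctf_dist (model b) G Q) {s. s (Y, x) = K \<and> s (Y', x') = K} =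
      card (E b) / card noise" for b
    using Q by (simp add: ctf_dist_def model_simps measure_pmf_of_set finite_noise noise_nonempty
        vimage_def Int_def E_def)
  from this[of True] this[of False] eq have "card (E True) = card (E False)"
    using finite_noise noise_nonempty by simp
  moreover have "b < K" if "b \<in> ran y" "(Z, y) \<in> Q" for b y Z
    using over that by (force simp: query_over_def ran_def)
  ultimately show False
    using joint_signal_differs[of Y x Y' x'] wf Q W P unfolding E_def wf_query_def by fast
qed

end

lemma identifiable_imp_layer_2_5:
  assumes G: "causal_diagram G" and wf: "wf_query G Q" and id: "identifiable_from_layer G L2_5 Q"
  shows "in_layer L2_5 G Q"
proof (rule ccontr)
  assume "\<not> in_layer L2_5 G Q"
  then obtain Y x Y' x' P W a where c: "(Y, x) \<in> Q" "(Y', x') \<in> Q" "(P, W) \<in> dir G"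
    "W \<in> An (cut_out G (dom x)) Y" "W \<in> An (cut_out G (dom x')) Y'"
    "x P = Some a" "x' P \<noteq> Some a"
    by (rule layer_2_5_conflict[OF G wf])
  have "finite (ran y)" if "(Z, y) \<in> Q" for Z y
    using wf G that finite_subset[of "dom y" "verts G"]
    by (auto simp: wf_query_def causal_diagram_def intro!: finite_ran)
  then have fin: "finite (\<Union>(Y, x)\<in>Q. ran x)"
    using wf by (auto simp: wf_query_def)
  then obtain N where N: "(\<Union>(Y, x)\<in>Q. ran x) \<subseteq> {..<N}"
    unfolding finite_nat_iff_bounded by blast
  \<comment> \<open>Above every value in the query, and at least 2 so that \<open>P\<close> has a
    value below \<open>K\<close> other than \<open>a\<close>.\<close>
  define K where "K = N + 2"
  have less: "b < K" if "(Z, y) \<in> Q" "y v = Some b" for Z y v b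
    using N that unfolding K_def by (fastforce simp: ran_def)
  then have "conflict_models G P W K a"
    using G c by unfold_locales (auto simp: K_def)
  moreover have "query_over (\<lambda>_. {..<K}) Q"
    using less by (auto simp: query_over_def)
  ultimately show False
    using conflict_models.not_identifiable wf c id by blast
qed


section \<open>Identifiability and realizability\<close>

lemma identifiable_lower_imp_layer_2_5:
  assumes G: "causal_diagram G" and Q: "in_layer i G Q"
    and j: "layer_index j < layer_index i" and id: "identifiable_from_layer G j Q"
  shows "in_layer L2_5 G Q"
proof (cases "i = L3")
  case True
  with j have "j \<noteq> L3" by auto
  with identifiable_imp_layer_2_5[OF G _ identifiable_from_layer_2_5[OF G id]] Q show ?thesis
    by (simp add: in_layer_def)
qed (rule layer_subset_layer_2_5[OF G Q])

text \<open>The query is a fixed image of one sampled distribution, and its assigned values depend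
  only on the domains, which both models share.\<close>

lemma realizable_imp_identifiable:
  assumes "realizable G A Q"
  shows "identifiable_from_available G A Q"
  unfolding identifiable_from_available_def identifiable_def
proof (intro allI impI)
  fix M N
  assume M: "compatible M G" and N: "compatible N G"
    and vals: "\<forall>v\<in>verts G. vals M v = vals N v" and over: "query_over (vals M) Q"
    and agree: "available_agree A G M N"
  from assms obtain R where R: "R \<subseteq> A"
    and D: "\<And>D. \<forall>v\<in>verts G. finite (D v) \<and> D v \<noteq> {} \<Longrightarrow> query_over D Q \<Longrightarrow>
      \<exists>a. assignment D R a \<and> (\<forall>M. compatible M G \<longrightarrow> (\<forall>v\<in>verts G. vals M v = D v) \<longrightarrow>
        ctf_dist M G Q = map_pmf (\<lambda>s. \<lambda>r\<in>Q. s (fst r)) (sampled_dist M G R a))"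
    unfolding realizable_def by blast
  have "\<forall>v\<in>verts G. finite (vals M v) \<and> vals M v \<noteq> {}"
    using M by (simp add: compatible_def)
  from D[OF this over] obtain a where a: "assignment (vals M) R a"
    and dist: "\<And>M'. compatible M' G \<Longrightarrow> \<forall>v\<in>verts G. vals M' v = vals M v \<Longrightarrow>
      ctf_dist M' G Q = map_pmf (\<lambda>s. \<lambda>r\<in>Q. s (fst r)) (sampled_dist M' G R a)"
    by blast
  have "sampled_dist M G R a = sampled_dist N G R a"
    using agree R a by (simp add: available_agree_def)
  with dist[OF M] dist[OF N] vals show "ctf_dist M G Q = ctf_dist N G Q" by simp
qed

section \<open>Witnesses for the two existence claims\<close>

lemma single_response_in_layer:
  assumes G: "causal_diagram G" and r: "Y \<in> verts G" "dom x \<subseteq> verts G" "Y \<notin> dom x" and i: "i \<noteq> L1"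
  shows "in_layer i G {(Y, x)}"
proof -
  have wf: "wf_query G {(Y, x)}" using r by (simp add: wf_query_def)
  have "in_layer L2_25 G {(Y, x)}"
    using wf r by (auto simp: in_layer_def intro!: exI[of _ x])
  with i wf layer_2_25_subset_layer_2_5[OF G this] show ?thesis
    by (cases i) (auto simp: in_layer_def)
qed

definition disconnected :: diagram where
  "disconnected = \<lparr>verts = {0, 1}, dir = {}, bidir = {}\<rparr>"

lemma causal_disconnected: "causal_diagram disconnected"
  by (simp add: causal_diagram_def disconnected_def sym_def irrefl_def acyclic_def)

text \<open>Vertex \<open>1\<close> has no parents, so intervening on \<open>0\<close> leaves its
  law unchanged: the query is observational in content but not in form.\<close>

lemma disconnected_intervention_identifiable:
  "identifiable_from_layer disconnected L1 {(1, [0 \<mapsto> 0])}"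
  unfolding identifiable_from_layer_def identifiable_def
proof (intro allI impI)
  fix M N
  assume M: "compatible M disconnected" and N: "compatible N disconnected"
    and agree: "layer_agree L1 disconnected M N"
  have *: "ctf_dist M' disconnected {(1, [0 \<mapsto> 0])} =
      map_pmf (\<lambda>s. \<lambda>r\<in>{(1, [0 \<mapsto> 0])}. s (1, Map.empty)) (ctf_dist M' disconnected {(1, Map.empty)})"
    if M': "compatible M' disconnected" for M'
  proof -
    have "mech M' 1 p e = mech M' 1 q e" for p q e
      using M' by (simp add: compatible_def parents_def disconnected_def)
    moreover have "1 \<in> verts disconnected" by (simp add: disconnected_def)
    ultimately have "potential_value M' disconnected (1, [0 \<mapsto> 0]) u =
        potential_value M' disconnected (1, Map.empty) u" for u
      using potential_value_eq[OF causal_disconnected M', of 1] by simp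
    then show ?thesis
      by (auto simp: ctf_dist_def map_pmf_comp intro!: map_pmf_cong restrict_ext)
  qed
  have "in_layer L1 disconnected {(1, Map.empty)}"
    by (simp add: in_layer_def wf_query_def disconnected_def)
  then have "ctf_dist M disconnected {(1, Map.empty)} = ctf_dist N disconnected {(1, Map.empty)}"
    using agree by (simp add: layer_agree_def query_over_def)
  then show "ctf_dist M disconnected {(1, [0 \<mapsto> 0])} = ctf_dist N disconnected {(1, [0 \<mapsto> 0])}"
    unfolding *[OF M] *[OF N] by simp
qed

text \<open>A constant generates only the trivial events, of probability 0 and 1, which are
  independent of everything. For \<open>bow\<close>, groups without a bidirected edge between them
  include an empty one.\<close>

lemma indep_var_constant:
  fixes p :: "'a pmf" and X Y :: "'a \<Rightarrow> 'b"
  assumes "(\<forall>u v. X u = X v) \<or> (\<forall>u v. Y u = Y v)"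
  shows "prob_space.indep_var (measure_pmf p) (count_space UNIV) X (count_space UNIV) Y"
proof -
  have trivial: "E = {} \<or> E = UNIV"
    if "\<forall>u v. Z u = Z v" "E \<in> sigma_sets UNIV {Z -` A \<inter> UNIV |A. A \<in> Pow UNIV}"
    for Z :: "'a \<Rightarrow> 'b" and E
    using that(2)
  proof induction
    case (Basic E)
    then obtain A where "E = Z -` A" by auto
    with that(1) show ?case by blast
  next
    case (Union F)
    then show ?case by (cases "\<exists>i. F i = UNIV") auto
  qed auto
  show ?thesis
    unfolding prob_space.indep_var_eq[OF measure_pmf.prob_space_axioms]
      prob_space.indep_sets2_eq[OF measure_pmf.prob_space_axioms]
    using assms trivial[of X] trivial[of Y]
    by (fastforce simp: measure_pmf.prob_space[simplified])
qed

definition bow :: diagram where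
  "bow = \<lparr>verts = {0, 1}, dir = {(0, 1)}, bidir = {(0, 1), (1, 0)}\<rparr>"

text \<open>
  A uniform \<open>k < 6\<close> encodes a fair coin \<open>k mod 2\<close>, copied by vertex \<open>0\<close>, and independently
  the event \<open>k div 2 = 0\<close> of probability 1/3 that vertex \<open>1\<close> is flipped. Whether vertex \<open>1\<close>
  follows the coin or its parent is invisible without intervention.
\<close>

definition bow_model :: "bool \<Rightarrow> scm" where
  "bow_model confounded = \<lparr>
     vals = (\<lambda>_. {0, 1}),
     mech = (\<lambda>v p k.
       if v = 0 then k mod 2
       else ((if confounded then k else p 0) + of_bool (k div 2 = 0)) mod 2),
     exo = map_pmf (\<lambda>k _. k) (pmf_of_set {..<6})\<rparr>"

lemma causal_bow: "causal_diagram bow"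
  by (auto simp: causal_diagram_def bow_def sym_def irrefl_def
      intro!: acyclic_subset[OF wf_acyclic[OF wf_less]])

lemma compatible_bow_model: "compatible (bow_model b) bow"
  unfolding compatible_def
proof (intro conjI allI ballI impI)
  fix A B
  assume "A \<subseteq> verts bow" "B \<subseteq> verts bow" "A \<inter> B = {}" "bidir bow \<inter> A \<times> B = {}"
  then have "A = {} \<or> B = {}" by (auto simp: bow_def)
  then show "prob_space.indep_var (measure_pmf (exo (bow_model b)))
      (count_space UNIV) (\<lambda>u. restrict u A) (count_space UNIV) (\<lambda>u. restrict u B)"
    by (intro indep_var_constant) auto
qed (auto simp: bow_model_def bow_def parents_def)

lemma bow_value:
  "potential_value (bow_model b) bow (0, Map.empty) u = u 0 mod 2"
  "potential_value (bow_model b) bow (1, Map.empty) u =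
    ((if b then u 1 else u 0 mod 2) + of_bool (u 1 div 2 = 0)) mod 2"
  "potential_value (bow_model b) bow (1, [0 \<mapsto> 0]) u =
    ((if b then u 1 else 0) + of_bool (u 1 div 2 = 0)) mod 2"
proof -
  have v: "0 \<in> verts bow" "1 \<in> verts bow" by (auto simp: bow_def)
  note eq = potential_value_eq[OF causal_bow compatible_bow_model]
  show 0: "potential_value (bow_model b) bow (0, Map.empty) u = u 0 mod 2"
    by (subst eq[OF v(1)]) (simp add: bow_model_def)
  have "potential_value (bow_model b) bow (0, [0 \<mapsto> 0]) u = 0"
    by (subst eq[OF v(1)]) simp
  then show "potential_value (bow_model b) bow (1, [0 \<mapsto> 0]) u =
    ((if b then u 1 else 0) + of_bool (u 1 div 2 = 0)) mod 2"
    by (subst eq[OF v(2)]) (simp add: bow_model_def)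
  show "potential_value (bow_model b) bow (1, Map.empty) u =
    ((if b then u 1 else u 0 mod 2) + of_bool (u 1 div 2 = 0)) mod 2"
    using 0 by (subst eq[OF v(2)]) (simp add: bow_model_def)
qed

lemma bow_layer_1:
  assumes "in_layer L1 bow Z" "r \<in> Z"
  shows "r = (0, Map.empty) \<or> r = (1, Map.empty)"
  using assms by (fastforce simp: in_layer_def wf_query_def bow_def)

lemma bow_layer_agree: "layer_agree L1 bow (bow_model True) (bow_model False)"
  unfolding layer_agree_def
proof (intro allI impI)
  fix Z assume Z: "in_layer L1 bow Z"
  \<comment> \<open>Both vertices receive the same \<open>k\<close>, so without intervention the
    parent equals the coin and the models agree pointwise.\<close>
  have "potential_value (bow_model True) bow r (\<lambda>_. k) =
      potential_value (bow_model False) bow r (\<lambda>_. k)" if "r \<in> Z" for r k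
    using bow_layer_1[OF Z that] by (auto simp: bow_value mod_simps simp del: One_nat_def)
  moreover have "exo (bow_model b) = map_pmf (\<lambda>k _. k) (pmf_of_set {..<6})" for b
    by (simp add: bow_model_def)
  ultimately show "ctf_dist (bow_model True) bow Z = ctf_dist (bow_model False) bow Z"
    by (auto simp: ctf_dist_def map_pmf_comp intro!: map_pmf_cong restrict_ext)
qed

lemma bow_layer_positive: "layer_positive L1 bow (bow_model b)"
  unfolding layer_positive_def
proof (intro allI impI ballI)
  fix Z z assume Z: "in_layer L1 bow Z" and "z \<in> (\<Pi>\<^sub>E r\<in>Z. vals (bow_model b) (fst r))"
  then have z: "z \<in> Z \<rightarrow>\<^sub>E {0, 1}" by (simp add: bow_model_def)
  define c where "c v = (if (v, Map.empty) \<in> Z then z (v, Map.empty) else 0)" for v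
  \<comment> \<open>The parity of \<open>k\<close> is the desired value of vertex \<open>0\<close>,
    and \<open>k < 2\<close> flips vertex \<open>1\<close> exactly when the desired values
    differ.\<close>
  define k where "k = (if c 0 = c 1 then 2 + c 0 else c 0)"
  have c: "c v = 0 \<or> c v = 1" for v using z by (auto simp: c_def)
  have "(\<lambda>r\<in>Z. potential_value (bow_model b) bow r (\<lambda>_. k)) = z"
  proof (rule extensionalityI[of _ Z])
    fix r assume r: "r \<in> Z"
    have "potential_value (bow_model b) bow (0, Map.empty) (\<lambda>_. k) = c 0"
      "potential_value (bow_model b) bow (1, Map.empty) (\<lambda>_. k) = c 1"
      using c[of 0] c[of 1] by (auto simp: bow_value k_def simp del: One_nat_def)
    then show "(\<lambda>r\<in>Z. potential_value (bow_model b) bow r (\<lambda>_. k)) r = z r"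
      using bow_layer_1[OF Z r] r by (auto simp: c_def)
  qed (use z in \<open>simp_all add: PiE_def\<close>)
  moreover have "k < 6" using c[of 0] by (auto simp: k_def)
  moreover have "set_pmf (exo (bow_model b)) = (\<lambda>k _. k) ` {..<6}"
    by (simp add: bow_model_def lessThan_empty_iff)
  ultimately have "z \<in> set_pmf (ctf_dist (bow_model b) bow Z)"
    unfolding ctf_dist_def set_map_pmf by (intro image_eqI[of _ _ "\<lambda>_. k"]) auto
  then show "pmf (ctf_dist (bow_model b) bow Z) z > 0"
    by (simp add: pmf_positive_iff)
qed

lemma bow_not_identifiable: "\<not> identifiable_from_layer bow L1 {(1, [0 \<mapsto> 0])}"
proof
  let ?Q = "{(1, [0 \<mapsto> 0])} :: query"
  assume "identifiable_from_layer bow L1 ?Q"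
  moreover have "query_over (vals (bow_model True)) ?Q"
    by (simp add: query_over_def bow_model_def)
  moreover have "vals (bow_model True) v = vals (bow_model False) v" for v
    by (simp add: bow_model_def)
  ultimately have eq: "ctf_dist (bow_model True) bow ?Q = ctf_dist (bow_model False) bow ?Q"
    unfolding identifiable_from_layer_def identifiable_def
    using compatible_bow_model bow_layer_positive bow_layer_agree by metis
  have "measure_pmf.prob (ctf_dist (bow_model b) bow ?Q) {s. s (1, [0 \<mapsto> 0]) = 0} =
      card ({..<6} \<inter> {k. ((if b then k else 0) + of_bool (k div 2 = 0)) mod 2 = (0::nat)}) / 6" for b
  proof -
    have "exo (bow_model b) = map_pmf (\<lambda>k _. k) (pmf_of_set {..<6})"
      by (simp add: bow_model_def)
    moreover have "{..<6::nat} \<noteq> {}" by (simp add: lessThan_empty_iff)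
    ultimately show ?thesis
      by (simp add: ctf_dist_def map_pmf_comp measure_pmf_of_set vimage_def bow_value del: One_nat_def)
  qed
  from this[of True] this[of False] eq
  have "card ({..<6} \<inter> {k::nat. (k + of_bool (k div 2 = 0)) mod 2 = (0::nat)}) =
      card ({..<6} \<inter> {k::nat. of_bool (k div 2 = 0) mod 2 = (0::nat)})"
    by simp
  moreover have six: "{..<6::nat} = {0, 1, 2, 3, 4, 5}" by auto
  \<comment> \<open>With vertex \<open>0\<close> set to 0, the confounded model still follows the
    coin and gives probability 3/6; the other gives 4/6, the probability of no flip.\<close>
  have "{..<6} \<inter> {k::nat. (k + of_bool (k div 2 = 0)) mod 2 = (0::nat)} = {1, 2, 4}"
    unfolding six by auto
  moreover have "{..<6} \<inter> {k::nat. of_bool (k div 2 = 0) mod 2 = (0::nat)} = {2, 3, 4, 5}"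
    unfolding six by auto
  ultimately show False by simp
qed

lemma bow_realizable: "realizable bow {Rand 0} {(1, [0 \<mapsto> 0])}"
  unfolding realizable_def
proof (intro exI[of _ "{Rand 0}"] conjI allI impI)
  fix D assume "query_over D {(1, [0 \<mapsto> 0])}"
  then have D: "0 \<in> D 0" by (simp add: query_over_def)
  show "\<exists>a. assignment D {Rand 0} a \<and>
      (\<forall>M. compatible M bow \<longrightarrow> (\<forall>v\<in>verts bow. vals M v = D v) \<longrightarrow>
        ctf_dist M bow {(1, [0 \<mapsto> 0])} =
        map_pmf (\<lambda>s. \<lambda>r\<in>{(1, [0 \<mapsto> 0])}. s (fst r)) (sampled_dist M bow {Rand 0} a))"
  proof (intro exI[of _ "\<lambda>_. 0"] conjI allI impI)
    show "assignment D {Rand 0} (\<lambda>_. 0)" using D by (simp add: assignment_def)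
    fix M :: scm
    \<comment> \<open>Randomizing \<open>0\<close> with assigned value 0 yields the same structural
      equations as the intervention, since no perceived value is altered separately.\<close>
    have "(\<lambda>v s. case [0 \<mapsto> 0] v of Some b \<Rightarrow> b | None \<Rightarrow> mech M v s (u v)) =
        (\<lambda>v s. if Rand v \<in> {Rand 0} then 0
          else mech M v (\<lambda>X. perceived {Rand 0} (\<lambda>_. 0) X v (s X)) (u v))" for u
      by (auto simp: perceived_def fun_eq_iff)
    then have "potential_value M bow (1, [0 \<mapsto> 0]) u = regime_value M bow {Rand 0} (\<lambda>_. 0) u 1" for u
      by (simp add: potential_value_def regime_value_def)
    moreover have "1 \<in> measured bow {Rand 0}" by (simp add: measured_def bow_def)
    ultimately show "ctf_dist M bow {(1, [0 \<mapsto> 0])} =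
        map_pmf (\<lambda>s. \<lambda>r\<in>{(1, [0 \<mapsto> 0])}. s (fst r)) (sampled_dist M bow {Rand 0} (\<lambda>_. 0))"
      by (auto simp: ctf_dist_def sampled_dist_def map_pmf_comp intro!: map_pmf_cong restrict_ext)
  qed
qed (auto simp: measured_def bow_def)

theorem corollary3p2:
  fixes i :: layer
  shows
    "(\<forall>G Q. causal_diagram G \<longrightarrow> in_layer i G Q \<longrightarrow>
        (\<exists>j. layer_index j < layer_index i \<and> identifiable_from_layer G j Q) \<longrightarrow>
        in_layer L2_5 G Q) \<and>
     (layer_index i > 1 \<longrightarrow>
        (\<exists>j G Q. layer_index j < layer_index i \<and> causal_diagram G \<and> in_layer i G Q \<and>
           identifiable_from_layer G j Q \<and> \<not> in_layer j G Q)) \<and>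
     (\<forall>G Q A. causal_diagram G \<longrightarrow> in_layer i G Q \<longrightarrow> A \<subseteq> actions G \<longrightarrow>
        realizable G A Q \<longrightarrow> identifiable_from_available G A Q) \<and>
     (layer_index i > 1 \<longrightarrow>
        (\<exists>j G A Q. layer_index j < layer_index i \<and> causal_diagram G \<and> A \<subseteq> actions G \<and>
           in_layer i G Q \<and> realizable G A Q \<and> \<not> identifiable_from_layer G j Q))"
proof (intro conjI impI)
  assume "layer_index i > 1"
  \<comment> \<open>Observational data serve as the lower layer in both existence claims, for every
    \<open>i\<close> above \<open>L1\<close>.\<close>
  then have j: "layer_index L1 < layer_index i" and i: "i \<noteq> L1" by auto
  have "in_layer i disconnected {(1, [0 \<mapsto> 0])}"
    by (rule single_response_in_layer[OF causal_disconnected _ _ _ i])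
      (auto simp: disconnected_def)
  moreover have "\<not> in_layer L1 disconnected {(1, [0 \<mapsto> 0])}"
    by (auto simp: in_layer_def dest: fun_cong[of _ _ 0])
  ultimately show "\<exists>j G Q. layer_index j < layer_index i \<and> causal_diagram G \<and> in_layer i G Q \<and>
      identifiable_from_layer G j Q \<and> \<not> in_layer j G Q"
    using j causal_disconnected disconnected_intervention_identifiable by blast
  have "in_layer i bow {(1, [0 \<mapsto> 0])}"
    by (rule single_response_in_layer[OF causal_bow _ _ _ i]) (auto simp: bow_def)
  moreover have "{Rand 0} \<subseteq> actions bow" by (simp add: actions_def bow_def)
  ultimately show "\<exists>j G A Q. layer_index j < layer_index i \<and> causal_diagram G \<and> A \<subseteq> actions G \<and>
      in_layer i G Q \<and> realizable G A Q \<and> \<not> identifiable_from_layer G j Q"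
    using j causal_bow bow_realizable bow_not_identifiable by blast
qed (blast intro: identifiable_lower_imp_layer_2_5 realizable_imp_identifiable)+

end
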